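(* Let $C\ge 1$. Let $E$ be a Banach space and let $\mathcal{M}$ be a family of finite metric spaces each of which is $C$-embeddable in $E$. Let $\beta>2(C+1)$. Then every space in $\operatorname{comp}_\beta(\mathcal{M})$ is $A$-embeddable in $E$, where $$A=C+\frac{2C(C+1)}{\beta-2(C+1)}.$$ In particular, for any $\varepsilon>0$, if $\beta>2\left(\frac{C+\varepsilon}{\varepsilon}\right)(C+1)$, then every space in $\operatorname{comp}_\beta(\mathcal{M})$ is $(C+\varepsilon)$-embeddable in $E$.
   Context: The distortion of an injective map $f:X\to Y$ between metric spaces is $\sup_{x\ne y}\frac{d_Y(f(x),f(y))}{d_X(x,y)}\cdot\sup_{x\ne y}\frac{d_X(x,y)}{d_Y(f(x),f(y))}$. A metric space $X$ is $K$-embeddable into $Y$ if there is an injective map $X\to Y$ of distortion at most $K$. Metric composition: let $M$ be a finite metric space, $\mathcal{N}=\{N_x\}_{x\in M}$ a collection of disjoint finite metric spaces indexed by the points of $M$, and $\beta\ge 1/2$. The $\beta$-composition $M_\beta[\mathcal{N}]$ is the disjoint union of the sets $N_x$, $x\in M$, with the following distance $d_\beta$: for $u\in N_x$, $v\in N_y$, $d_\beta(u,v)=d_{N_x}(u,v)$ if $x=y$, and $d_\beta(u,v)=\beta\gamma\, d_M(x,y)$ if $x\neq y$, where $\gamma=\frac{\max_{z\in M}\operatorname{diam}(N_z)}{\min_{x\ne y\in M}d_M(x,y)}$. The composition is understood only for data for which this is a metric, i.e. $\gamma>0$ (at least one $N_x$ has more than one point); if $M$ has a single point $x$, then $M_\beta[\mathcal{N}]$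 is $N_x$. Closure under compositions: for a class $\mathcal{M}$ of finite metric spaces and $\beta\ge 1$, $\operatorname{comp}_\beta(\mathcal{M})$ is the smallest class $\mathcal{C}$ of metric spaces that contains all spaces in $\mathcal{M}$ and satisfies: whenever $M\in\mathcal{M}$, $\beta'\ge\beta$, and with every $x\in M$ there is associated a metric space $N_x$ isometric to a space in $\mathcal{C}$, the space $M_{\beta'}[\{N_x\}_{x\in M}]$ is also in $\mathcal{C}$. Equivalently, $\operatorname{comp}_\beta(\mathcal{M})=\bigcup_{m\ge 0}\mathcal{C}_m$, where $\mathcal{C}_0=\mathcal{M}$ and $\mathcal{C}_m$ consists of the spaces $M_{\beta'}[\{N_x\}_{x\in M}]$ with $M\in\mathcal{M}$, $\beta'\ge\beta$, and each $N_x$ isometric to a space in $\bigcup_{i<m}\mathcal{C}_i$. *)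

theory Defs
  imports "HOL-Analysis.Analysis"
begin

text \<open>
  Metric spaces are elements of the library type \<^typ>\<open>'a metric\<close>, so that they can be collected
  into classes.  Only the values of \<^const>\<open>mdist\<close> on \<^const>\<open>mspace\<close> are meaningful.
\<close>

definition isometric_spaces :: "'a metric \<Rightarrow> 'b metric \<Rightarrow> bool" where
  "isometric_spaces X Y \<longleftrightarrow>
     (\<exists>f. bij_betw f (mspace X) (mspace Y) \<and>
          (\<forall>x\<in>mspace X. \<forall>y\<in>mspace X. mdist Y (f x) (f y) = mdist X x y))"

text \<open>
  The suprema are taken in \<^typ>\<open>ennreal\<close>: they may be infinite, and the supremum of the empty
  set is \<open>0\<close>, so every map from a space with at most one point has distortion \<open>0\<close>.
  On larger spaces both factors are positive when \<open>f\<close> is injective, hence no product of \<open>0\<close>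
  and infinity occurs.
\<close>

definition distortion :: "'a metric \<Rightarrow> 'b metric \<Rightarrow> ('a \<Rightarrow> 'b) \<Rightarrow> ennreal" where
  "distortion X Y f =
     (SUP (x, y) \<in> {(x, y). x \<in> mspace X \<and> y \<in> mspace X \<and> x \<noteq> y}.
        ennreal (mdist Y (f x) (f y) / mdist X x y)) *
     (SUP (x, y) \<in> {(x, y). x \<in> mspace X \<and> y \<in> mspace X \<and> x \<noteq> y}.
        ennreal (mdist X x y / mdist Y (f x) (f y)))"

definition embeddable :: "real \<Rightarrow> 'a metric \<Rightarrow> 'b metric \<Rightarrow> bool" where
  "embeddable K X Y \<longleftrightarrow>
     (\<exists>f. f \<in> mspace X \<rightarrow> mspace Y \<and> inj_on f (mspace X) \<and> distortion X Y f \<le> ennreal K)"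

definition diam :: "'a metric \<Rightarrow> real" where
  "diam X = (SUP (u, v) \<in> mspace X \<times> mspace X. mdist X u v)"

definition comp_gamma :: "'i metric \<Rightarrow> ('i \<Rightarrow> 'a metric) \<Rightarrow> real" where
  "comp_gamma M N =
     (MAX z \<in> mspace M. diam (N z)) /
     Min {mdist M x y | x y. x \<in> mspace M \<and> y \<in> mspace M \<and> x \<noteq> y}"

text \<open>
  The data for which the composition is understood.  If \<open>M\<close> has a single point, \<^const>\<open>comp_gamma\<close>
  is a junk value, but it is then not used by \<open>composition\<close>.
\<close>

definition composable :: "real \<Rightarrow> 'i metric \<Rightarrow> ('i \<Rightarrow> 'a metric) \<Rightarrow> bool" where
  "composable \<beta> M N \<longleftrightarrow>
     1/2 \<le> \<beta> \<and> finite (mspace M) \<and> mspace M \<noteq> {} \<and>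
     (\<forall>x\<in>mspace M. finite (mspace (N x)) \<and> mspace (N x) \<noteq> {}) \<and>
     disjoint_family_on (\<lambda>x. mspace (N x)) (mspace M) \<and>
     (is_singleton (mspace M) \<or> comp_gamma M N > 0)"

definition comp_index :: "'i metric \<Rightarrow> ('i \<Rightarrow> 'a metric) \<Rightarrow> 'a \<Rightarrow> 'i" where
  "comp_index M N u = (THE x. x \<in> mspace M \<and> u \<in> mspace (N x))"

text \<open>
  The value \<open>0\<close> off the carrier is arbitrary, but \<^const>\<open>metric\<close> expects a function that is
  symmetric and nonnegative everywhere.
\<close>

definition comp_dist :: "real \<Rightarrow> 'i metric \<Rightarrow> ('i \<Rightarrow> 'a metric) \<Rightarrow> 'a \<Rightarrow> 'a \<Rightarrow> real" where
  "comp_dist \<beta> M N u v =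
     (if u \<in> (\<Union>x\<in>mspace M. mspace (N x)) \<and> v \<in> (\<Union>x\<in>mspace M. mspace (N x)) then
        let x = comp_index M N u; y = comp_index M N v in
        if x = y then mdist (N x) u v else \<beta> * comp_gamma M N * mdist M x y
      else 0)"

definition composition :: "real \<Rightarrow> 'i metric \<Rightarrow> ('i \<Rightarrow> 'a metric) \<Rightarrow> 'a metric" where
  "composition \<beta> M N = metric (\<Union>x\<in>mspace M. mspace (N x), comp_dist \<beta> M N)"

text \<open>
  All spaces live in one type \<open>'a\<close>.  When \<open>'a\<close> is infinite, it contains a copy of every finite
  metric space, and disjoint copies of any finitely many of them.
\<close>

inductive_set comp_closure :: "real \<Rightarrow> 'a metric set \<Rightarrow> 'a metric set"
  for \<beta> :: real and \<M> :: "'a metric set" where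
  base: "M \<in> \<M> \<Longrightarrow> M \<in> comp_closure \<beta> \<M>"
| comp: "M \<in> \<M> \<Longrightarrow> \<beta> \<le> \<beta>' \<Longrightarrow> composable \<beta>' M N \<Longrightarrow>
         (\<forall>x\<in>mspace M. \<exists>Y. Y \<in> comp_closure \<beta> \<M> \<and> isometric_spaces (N x) Y) \<Longrightarrow>
         composition \<beta>' M N \<in> comp_closure \<beta> \<M>"

lemma comp_index_eq:
  assumes "composable \<beta> M N" "x \<in> mspace M" "u \<in> mspace (N x)"
  shows "comp_index M N u = x"
  unfolding comp_index_def
proof (rule the_equality)
  fix y assume "y \<in> mspace M \<and> u \<in> mspace (N y)"
  then show "y = x"
    using assms unfolding composable_def disjoint_family_on_def by blast
qed (use assms in auto)

lemma mdist_le_diam: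
  assumes "finite (mspace X)" "u \<in> mspace X" "v \<in> mspace X"
  shows "mdist X u v \<le> diam X"
proof -
  have "(\<lambda>(u, v). mdist X u v) (u, v) \<le> (SUP p \<in> mspace X \<times> mspace X. (\<lambda>(u, v). mdist X u v) p)"
    by (rule cSUP_upper) (use assms in \<open>auto intro!: bdd_above_finite\<close>)
  then show ?thesis by (simp add: diam_def)
qed

lemma mdist_le_comp_gamma:
  assumes c: "composable \<beta> M N"
    and x: "x \<in> mspace M" and y: "y \<in> mspace M" and "x \<noteq> y"
    and z: "z \<in> mspace M" and u: "u \<in> mspace (N z)" and v: "v \<in> mspace (N z)"
  shows "0 < \<beta> * comp_gamma M N * mdist M x y"
    and "mdist (N z) u v \<le> 2 * (\<beta> * comp_gamma M N * mdist M x y)"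
proof -
  let ?S = "{mdist M x y | x y. x \<in> mspace M \<and> y \<in> mspace M \<and> x \<noteq> y}"
  let ?D = "MAX z \<in> mspace M. diam (N z)"
  have fin: "finite (mspace M)" and b: "1/2 \<le> \<beta>" using c by (auto simp: composable_def)
  have g: "0 < comp_gamma M N"
    using c x y \<open>x \<noteq> y\<close> by (auto simp: composable_def is_singleton_def)
  have dxy: "0 < mdist M x y"
    using x y \<open>x \<noteq> y\<close> by (metis less_eq_real_def mdist_nonneg mdist_zero)
  show "0 < \<beta> * comp_gamma M N * mdist M x y"
    using g b dxy by simp
  have "?S \<subseteq> (\<lambda>(x, y). mdist M x y) ` (mspace M \<times> mspace M)" by auto
  then have finS: "finite ?S" using fin by (meson finite_SigmaI finite_imageI finite_subset)
  have inS: "mdist M x y \<in> ?S" using x y \<open>x \<noteq> y\<close> by blast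
  have "Min ?S \<in> ?S" using finS inS by (metis (no_types, lifting) Min_in empty_iff)
  then have pos: "0 < Min ?S"
    by (smt (verit, best) mdist_nonneg mdist_zero mem_Collect_eq)
  have "mdist (N z) u v \<le> diam (N z)"
    using c z u v by (intro mdist_le_diam) (auto simp: composable_def)
  also have "\<dots> \<le> ?D" using fin z by (intro Max_ge) auto
  also have "\<dots> = comp_gamma M N * Min ?S" using pos by (simp add: comp_gamma_def)
  also have "\<dots> \<le> comp_gamma M N * mdist M x y"
    using g Min_le[OF finS inS] by (simp add: mult_left_mono)
  also have "\<dots> \<le> (2 * \<beta>) * (comp_gamma M N * mdist M x y)"
    using b g dxy mult_right_mono[of 1 "2 * \<beta>" "comp_gamma M N * mdist M x y"] by simp
  finally show "mdist (N z) u v \<le> 2 * (\<beta> * comp_gamma M N * mdist M x y)" by (simp add: mult.assoc)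
qed

lemma Metric_space_composition:
  assumes c: "composable \<beta> M N"
  shows "Metric_space (\<Union>x\<in>mspace M. mspace (N x)) (comp_dist \<beta> M N)"
proof -
  let ?c = "\<beta> * comp_gamma M N"
  have d: "comp_dist \<beta> M N u v = (if x = y then mdist (N x) u v else ?c * mdist M x y)"
    if "x \<in> mspace M" "u \<in> mspace (N x)" "y \<in> mspace M" "v \<in> mspace (N y)" for x y u v
    using that comp_index_eq[OF c that(1,2)] comp_index_eq[OF c that(3,4)]
    by (auto simp: comp_dist_def Let_def)
  have inj: "x = y" if "x \<in> mspace M" "u \<in> mspace (N x)" "y \<in> mspace M" "u \<in> mspace (N y)" for x y u
    using comp_index_eq[OF c that(1,2)] comp_index_eq[OF c that(3,4)] by simp
  note bnd = mdist_le_comp_gamma[OF c]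
  show ?thesis
  proof
    fix u v
    show "0 \<le> comp_dist \<beta> M N u v"
    proof (cases "u \<in> (\<Union>x\<in>mspace M. mspace (N x)) \<and> v \<in> (\<Union>x\<in>mspace M. mspace (N x))")
      case True
      then obtain x y where "x \<in> mspace M" "u \<in> mspace (N x)" "y \<in> mspace M" "v \<in> mspace (N y)"
        by blast
      then show ?thesis using d bnd(1)[of x y x u u] by (auto simp: less_imp_le)
    qed (auto simp: comp_dist_def)
    show "comp_dist \<beta> M N u v = comp_dist \<beta> M N v u"
      by (auto simp: comp_dist_def Let_def mdist_commute)
  next
    fix u v assume "u \<in> (\<Union>x\<in>mspace M. mspace (N x))" "v \<in> (\<Union>x\<in>mspace M. mspace (N x))"
    then obtain x y where xy: "x \<in> mspace M" "u \<in> mspace (N x)" "y \<in> mspace M" "v \<in> mspace (N y)"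
      by blast
    show "comp_dist \<beta> M N u v = 0 \<longleftrightarrow> u = v"
    proof (cases "x = y")
      case True then show ?thesis using d[OF xy] xy by simp
    next
      case False
      then have "u \<noteq> v" using inj xy by blast
      then show ?thesis using d[OF xy] False bnd(1)[of x y x u u] xy by auto
    qed
  next
    fix u v w
    assume "u \<in> (\<Union>x\<in>mspace M. mspace (N x))" "v \<in> (\<Union>x\<in>mspace M. mspace (N x))"
      "w \<in> (\<Union>x\<in>mspace M. mspace (N x))"
    then obtain x y z where xyz: "x \<in> mspace M" "u \<in> mspace (N x)" "y \<in> mspace M" "v \<in> mspace (N y)"
      "z \<in> mspace M" "w \<in> mspace (N z)"
      by blast
    note ds = d[OF xyz(1-4)] d[OF xyz(3-6)] d[OF xyz(1,2,5,6)]
    consider "x = y" "y = z" | "x = y" "y \<noteq> z" | "x \<noteq> y" "y = z" | "x = z" "x \<noteq> y"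
      | "x \<noteq> y" "y \<noteq> z" "x \<noteq> z" by blast
    then show "comp_dist \<beta> M N u w \<le> comp_dist \<beta> M N u v + comp_dist \<beta> M N v w"
    proof cases
      case 1 then show ?thesis using ds xyz mdist_triangle by auto
    next
      case 2 then show ?thesis using ds by auto
    next
      case 3 then show ?thesis using ds by auto
    next
      case 4 then show ?thesis
        using ds xyz bnd(2)[of x y x u w] by (auto simp: mdist_commute)
    next
      case 5
      have "0 < ?c * mdist M x y" using bnd(1)[of x y x u u] 5 xyz by auto
      then have "0 \<le> ?c"
        using mdist_nonneg[of M x y] by (smt (verit) mult_nonpos_nonneg)
      then have "?c * mdist M x z \<le> ?c * (mdist M x y + mdist M y z)"
        using mdist_triangle xyz by (metis mult_left_mono)
      then show ?thesis using ds 5 by (simp add: distrib_left)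
    qed
  qed
qed

lemma mspace_composition:
  "composable \<beta> M N \<Longrightarrow> mspace (composition \<beta> M N) = (\<Union>x\<in>mspace M. mspace (N x))"
  by (simp add: composition_def Metric_space.mspace_metric[OF Metric_space_composition])

lemma mdist_composition:
  assumes c: "composable \<beta> M N"
    and "x \<in> mspace M" "u \<in> mspace (N x)" "y \<in> mspace M" "v \<in> mspace (N y)"
  shows "mdist (composition \<beta> M N) u v =
           (if x = y then mdist (N x) u v else \<beta> * comp_gamma M N * mdist M x y)"
  using assms(2-) comp_index_eq[OF c assms(2,3)] comp_index_eq[OF c assms(4,5)]
  by (auto simp: composition_def Metric_space.mdist_metric[OF Metric_space_composition[OF c]]
      comp_dist_def Let_def)

end

theory Submission
  imports Defs
begin

text \<open>
  In a normed space a map of distortion at most \<open>K\<close> can be rescaled so that it does not contract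
  any distance and expands none by more than the factor \<open>K\<close>; in this form embeddings of the pieces
  of a composition can be added up (\<open>embeddable_euclidean_iff\<close>).

  Let \<open>g\<close> be such an embedding of \<open>M\<close> with factor \<open>C\<close>, and \<open>h\<^sub>x\<close> one of \<open>N\<^sub>x\<close> with factor \<open>A\<close>,
  translated so that it sends a chosen point to \<open>0\<close>.  Then \<open>h\<^sub>x\<close> has norm at most
  \<open>A * diam N\<^sub>x\<close>, and \<open>diam N\<^sub>x \<le> \<gamma> * d\<^sub>M x y\<close> for all \<open>y \<noteq> x\<close>, which is \<open>1 / \<beta>\<close> of the distance
  between the pieces \<open>N\<^sub>x\<close> and \<open>N\<^sub>y\<close> in the composition.  So the map
  \<open>u \<mapsto> (1 + 2 * A / \<beta>) * \<beta> * \<gamma> * g x + h\<^sub>x u\<close>, for \<open>u \<in> N\<^sub>x\<close>, agrees with the first summand up to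
  an error of \<open>2 * A / \<beta>\<close> times the distance of points in different pieces.  The factor
  \<open>1 + 2 * A / \<beta>\<close> makes the map noncontracting in spite of this error, and the expansion becomes at
  most \<open>C * (1 + 2 * A / \<beta>) + 2 * A / \<beta> = C + 2 * A * (C + 1) / \<beta>\<close>
  (\<open>expansion_embedding_composition\<close>).

  Iterating compositions does not increase the bound \<open>A\<close> on the expansion if \<open>A\<close> is the fixed point
  \<open>A = C + 2 * A * (C + 1) / \<beta>\<close>, that is \<open>A = C + 2 * C * (C + 1) / (\<beta> - 2 * (C + 1))\<close>.
  Because a piece is translated by the value at one of its own points, its expansion bound already
  bounds its norm, and the bound \<open>A\<close> alone can serve as induction hypothesis over the closure.
\<close>

definition expansion_embedding :: "real \<Rightarrow> 'a metric \<Rightarrow> ('a \<Rightarrow> 'e::real_normed_vector) \<Rightarrow> bool" where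
  "expansion_embedding K X f \<longleftrightarrow>
     (\<forall>u\<in>mspace X. \<forall>v\<in>mspace X.
        mdist X u v \<le> norm (f u - f v) \<and> norm (f u - f v) \<le> K * mdist X u v)"

lemma expansion_embeddingD:
  assumes "expansion_embedding K X f" "u \<in> mspace X" "v \<in> mspace X"
  shows "mdist X u v \<le> norm (f u - f v)" "norm (f u - f v) \<le> K * mdist X u v"
  using assms by (auto simp: expansion_embedding_def)

lemma mdist_pos:
  assumes "x \<in> mspace X" "y \<in> mspace X" "x \<noteq> y"
  shows "0 < mdist X x y"
  using assms by (metis less_eq_real_def mdist_nonneg mdist_zero)

text \<open>
  For a space with two distinct points both suprema in the distortion are positive, so a finite
  product makes both finite; multiplying the map by the second supremum moves all of the
  distortion into the expansion.
\<close>

lemma embeddable_euclidean_iff: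
  fixes X :: "'a metric"
  shows "embeddable K X (euclidean_metric :: 'e::real_normed_vector metric) \<longleftrightarrow>
         (\<exists>f :: 'a \<Rightarrow> 'e. expansion_embedding K X f)"
proof
  assume "embeddable K X (euclidean_metric :: 'e metric)"
  then obtain f :: "'a \<Rightarrow> 'e" where inj: "inj_on f (mspace X)"
    and dis: "distortion X euclidean_metric f \<le> ennreal K"
    by (auto simp: embeddable_def)
  let ?P = "{(x, y). x \<in> mspace X \<and> y \<in> mspace X \<and> x \<noteq> y}"
  define a where "a = (SUP (x, y) \<in> ?P. ennreal (norm (f x - f y) / mdist X x y))"
  define b where "b = (SUP (x, y) \<in> ?P. ennreal (mdist X x y / norm (f x - f y)))"
  have ab: "a * b \<le> ennreal K"
    using dis by (simp add: distortion_def a_def b_def dist_norm)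
  have a_ge: "ennreal (norm (f x - f y) / mdist X x y) \<le> a"
    and b_ge: "ennreal (mdist X x y / norm (f x - f y)) \<le> b"
    and pos: "0 < norm (f x - f y)" "0 < mdist X x y" if "(x, y) \<in> ?P" for x y
  proof -
    show "ennreal (norm (f x - f y) / mdist X x y) \<le> a"
      unfolding a_def by (rule SUP_upper2[OF that]) simp
    show "ennreal (mdist X x y / norm (f x - f y)) \<le> b"
      unfolding b_def by (rule SUP_upper2[OF that]) simp
    show "0 < norm (f x - f y)" using that inj by (auto dest: inj_onD)
    show "0 < mdist X x y" using that mdist_pos by auto
  qed
  show "\<exists>f :: 'a \<Rightarrow> 'e. expansion_embedding K X f"
  proof (cases "?P = {}")
    case True
    then have zero: "mdist X u v = 0" if "u \<in> mspace X" "v \<in> mspace X" for u v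
      using that by auto
    have "expansion_embedding K X (\<lambda>_. 0 :: 'e)"
      by (simp add: expansion_embedding_def zero)
    then show ?thesis by blast
  next
    case False
    then obtain x y where xy: "(x, y) \<in> ?P" by auto
    have "0 < a" "0 < b"
      using a_ge[OF xy] b_ge[OF xy] pos[OF xy]
      by (meson divide_pos_pos ennreal_less_zero_iff less_le_trans)+
    moreover have "a * b < top"
      using ab by (rule le_less_trans) simp
    ultimately have "a < top" "b < top"
      by (auto simp: ennreal_mult_less_top)
    then obtain a' b' where a': "a = ennreal a'" "0 \<le> a'" and b': "b = ennreal b'" "0 \<le> b'"
      by (cases a; cases b) auto
    have "0 < a'" "0 < b'"
      using \<open>0 < a\<close> \<open>0 < b\<close> a' b' by auto
    then have K: "a' * b' \<le> K"
      using ab a' b' mult_pos_pos[OF \<open>0 < a'\<close> \<open>0 < b'\<close>]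
      by (auto simp: ennreal_mult[symmetric] ennreal_le_iff2)
    have "expansion_embedding K X (\<lambda>u. b' *\<^sub>R f u)"
      unfolding expansion_embedding_def
    proof (intro ballI)
      fix u v assume uv: "u \<in> mspace X" "v \<in> mspace X"
      have n: "norm (b' *\<^sub>R f u - b' *\<^sub>R f v) = b' * norm (f u - f v)"
        using b' by (simp flip: scaleR_diff_right)
      show "mdist X u v \<le> norm (b' *\<^sub>R f u - b' *\<^sub>R f v) \<and>
            norm (b' *\<^sub>R f u - b' *\<^sub>R f v) \<le> K * mdist X u v"
      proof (cases "u = v")
        case True
        then have "mdist X u v = 0" using uv by simp
        with True show ?thesis by simp
      next
        case False
        then have P: "(u, v) \<in> ?P" using uv by simp
        have A: "norm (f u - f v) \<le> a' * mdist X u v"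
          using a_ge[OF P] pos[OF P] a' by (simp add: divide_le_eq)
        have B: "mdist X u v \<le> b' * norm (f u - f v)"
          using b_ge[OF P] pos[OF P] b' by (simp add: divide_le_eq)
        have "b' * norm (f u - f v) \<le> (a' * b') * mdist X u v"
          using mult_left_mono[OF A b'(2)] by (simp add: mult_ac)
        also have "\<dots> \<le> K * mdist X u v"
          using K by (simp add: mult_right_mono)
        finally show ?thesis using B n by simp
      qed
    qed
    then show ?thesis by blast
  qed
next
  assume "\<exists>f :: 'a \<Rightarrow> 'e. expansion_embedding K X f"
  then obtain f :: "'a \<Rightarrow> 'e" where f: "expansion_embedding K X f" ..
  have pos: "0 < norm (f u - f v)" if "u \<in> mspace X" "v \<in> mspace X" "u \<noteq> v" for u v
    using expansion_embeddingD(1)[OF f that(1,2)] mdist_pos[OF that] by linarith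
  have "inj_on f (mspace X)"
    using pos by (fastforce intro!: inj_onI)
  moreover have "distortion X euclidean_metric f \<le> ennreal K * 1"
    unfolding distortion_def
  proof (intro mult_mono SUP_least)
    fix p assume p: "p \<in> {(x, y). x \<in> mspace X \<and> y \<in> mspace X \<and> x \<noteq> y}"
    then show "(case p of (x, y) \<Rightarrow> ennreal (mdist euclidean_metric (f x) (f y) / mdist X x y))
                 \<le> ennreal K"
      using expansion_embeddingD(2)[OF f] mdist_pos[of _ X]
      by (auto simp: dist_norm divide_le_eq intro!: ennreal_leI)
    from p show "(case p of (x, y) \<Rightarrow> ennreal (mdist X x y / mdist euclidean_metric (f x) (f y)))
                   \<le> 1"
      using expansion_embeddingD(1)[OF f] pos
      by (auto simp: dist_norm divide_le_eq)
  qed auto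
  ultimately show "embeddable K X (euclidean_metric :: 'e metric)"
    by (auto simp: embeddable_def)
qed

lemma embeddable_mono:
  assumes "embeddable K X Y" "K \<le> L"
  shows "embeddable L X Y"
  using assms unfolding embeddable_def by (meson ennreal_leI order_trans)

lemma expansion_embedding_isometric:
  assumes "isometric_spaces X Y" "expansion_embedding K Y f"
  shows "\<exists>g. expansion_embedding K X (f \<circ> g)"
proof -
  obtain g where bij: "bij_betw g (mspace X) (mspace Y)"
    and g: "\<forall>x\<in>mspace X. \<forall>y\<in>mspace X. mdist Y (g x) (g y) = mdist X x y"
    using assms(1) by (auto simp: isometric_spaces_def)
  have "g x \<in> mspace Y" if "x \<in> mspace X" for x
    using bij that by (rule bij_betw_apply)
  then have "expansion_embedding K X (f \<circ> g)"
    using assms(2) g unfolding expansion_embedding_def comp_apply by metis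
  then show ?thesis by blast
qed

text \<open>
  The scale \<open>comp_gamma\<close> does not depend on the composition parameter, and the parameter \<open>1/2\<close>, the
  smallest admissible one, gives the sharpest bound on the pieces.
\<close>

lemma mdist_piece_le_comp_gamma:
  assumes "composable \<beta> M N" "x \<in> mspace M" "y \<in> mspace M" "x \<noteq> y"
    and "z \<in> mspace M" "u \<in> mspace (N z)" "v \<in> mspace (N z)"
  shows "mdist (N z) u v \<le> comp_gamma M N * mdist M x y"
proof -
  have "composable (1/2) M N" using assms(1) by (simp add: composable_def)
  from mdist_le_comp_gamma(2)[OF this assms(2-)] show ?thesis by simp
qed

text \<open>
  The images of two points in one piece share the summand coming from \<open>g\<close>, so their distance is
  the one given by the embedding of that piece.  For points in different pieces \<open>N x\<close> and \<open>N y\<close>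
  the two translated embeddings of the pieces are an error of at most
  \<open>2 * A * comp_gamma M N * mdist M x y\<close>.
\<close>

lemma expansion_embedding_composition:
  fixes g :: "'i \<Rightarrow> 'e::real_normed_vector" and h :: "'i \<Rightarrow> 'a \<Rightarrow> 'e"
  assumes c: "composable \<beta> M N"
    and g: "expansion_embedding C M g"
    and h: "\<And>x. x \<in> mspace M \<Longrightarrow> expansion_embedding A (N x) (h x)"
    and "0 \<le> A" and rec: "C + 2 * A * (C + 1) / \<beta> \<le> A"
  shows "\<exists>f :: 'a \<Rightarrow> 'e. expansion_embedding A (composition \<beta> M N) f"
proof -
  have \<beta>: "0 < \<beta>" using c by (simp add: composable_def)
  let ?\<gamma> = "comp_gamma M N"
  have "\<forall>x\<in>mspace M. \<exists>p. p \<in> mspace (N x)"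
    using c by (auto simp: composable_def)
  then obtain p where p: "\<And>x. x \<in> mspace M \<Longrightarrow> p x \<in> mspace (N x)"
    by metis
  \<comment> \<open>The scale \<open>\<beta> * ?\<gamma>\<close> of the composition, enlarged by the factor \<open>1 + 2 * A / \<beta>\<close> that
    compensates the error made by the pieces.\<close>
  define s where "s = (\<beta> + 2 * A) * ?\<gamma>"
  define f where "f u = (let x = comp_index M N u in s *\<^sub>R g x + (h x u - h x (p x)))" for u
  have f: "f u = s *\<^sub>R g x + (h x u - h x (p x))" if "x \<in> mspace M" "u \<in> mspace (N x)" for x u
    using comp_index_eq[OF c that] by (simp add: f_def)
  have "expansion_embedding A (composition \<beta> M N) f"
    unfolding expansion_embedding_def
  proof (intro ballI)
    fix u v
    assume "u \<in> mspace (composition \<beta> M N)" "v \<in> mspace (composition \<beta> M N)"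
    then obtain x y where x: "x \<in> mspace M" "u \<in> mspace (N x)"
      and y: "y \<in> mspace M" "v \<in> mspace (N y)"
      by (auto simp: mspace_composition[OF c])
    let ?d = "mdist (composition \<beta> M N) u v"
    note d = mdist_composition[OF c x y]
    show "?d \<le> norm (f u - f v) \<and> norm (f u - f v) \<le> A * ?d"
    proof (cases "x = y")
      case True
      then show ?thesis
        using d x y h[OF x(1)] by (auto simp: f expansion_embedding_def)
    next
      case False
      define m where "m = ?\<gamma> * mdist M x y"
      have m: "0 < m"
        using mdist_le_comp_gamma(1)[OF c x(1) y(1) False x x(2)] \<beta>
        by (simp add: m_def mult.assoc zero_less_mult_iff)
      then have "0 < ?\<gamma>"
        using mdist_nonneg[of M x y] by (simp add: m_def zero_less_mult_iff)
      then have s: "0 \<le> s" using \<beta> \<open>0 \<le> A\<close> by (simp add: s_def)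
      have small: "norm (h z w - h z (p z)) \<le> A * m" if "z \<in> mspace M" "w \<in> mspace (N z)" for z w
      proof -
        have "norm (h z w - h z (p z)) \<le> A * mdist (N z) w (p z)"
          using expansion_embeddingD(2)[OF h] that p by blast
        also have "\<dots> \<le> A * m"
          using mdist_piece_le_comp_gamma[OF c x(1) y(1) False that(1) that(2) p] that \<open>0 \<le> A\<close>
          by (simp add: m_def mult_left_mono)
        finally show ?thesis .
      qed
      define G where "G = s *\<^sub>R (g x - g y)"
      define H where "H = (h x u - h x (p x)) - (h y v - h y (p y))"
      have fGH: "f u - f v = G + H"
        using x y by (simp add: f G_def H_def algebra_simps)
      have H: "norm H \<le> 2 * A * m"
        using norm_triangle_ineq4[of "h x u - h x (p x)" "h y v - h y (p y)"] small[OF x] small[OF y]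
        by (simp add: H_def)
      have nG: "norm G = s * norm (g x - g y)"
        using s by (simp add: G_def)
      have sm: "s * mdist M x y = (\<beta> + 2 * A) * m"
        by (simp add: s_def m_def)
      have G1: "(\<beta> + 2 * A) * m \<le> norm G"
        using mult_left_mono[OF expansion_embeddingD(1)[OF g x(1) y(1)] s] by (simp add: nG sm)
      have G2: "norm G \<le> C * ((\<beta> + 2 * A) * m)"
        using mult_left_mono[OF expansion_embeddingD(2)[OF g x(1) y(1)] s]
        by (simp add: nG flip: sm) (simp add: mult_ac)
      have dm: "?d = \<beta> * m" using d False by (simp add: m_def)
      have "?d \<le> norm (f u - f v)"
        using norm_diff_ineq[of G H] H G1 by (simp add: fGH dm algebra_simps)
      moreover have "norm (f u - f v) \<le> A * ?d"
      proof -
        have "norm (f u - f v) \<le> C * ((\<beta> + 2 * A) * m) + 2 * A * m"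
          unfolding fGH using norm_triangle_ineq[of G H] H G2 by linarith
        also have "\<dots> = (C + 2 * A * (C + 1) / \<beta>) * (\<beta> * m)"
          using \<beta> by (simp add: field_simps)
        also have "\<dots> \<le> A * (\<beta> * m)"
          using rec \<beta> m by (intro mult_right_mono) auto
        finally show ?thesis by (simp add: dm)
      qed
      ultimately show ?thesis ..
    qed
  qed
  then show ?thesis by blast
qed

text \<open>
  The constant is the fixed point of \<open>A \<mapsto> C + 2 * A * (C + 1) / \<beta>\<close>, so a composition inherits it
  from its pieces; a parameter \<open>\<beta>' \<ge> \<beta>\<close> only makes the error term smaller.
\<close>

lemma expansion_embedding_comp_closure:
  fixes \<M> :: "'a metric set"
  assumes "1 \<le> C" and emb: "\<And>M. M \<in> \<M> \<Longrightarrow> \<exists>g :: 'a \<Rightarrow> 'e::real_normed_vector. expansion_embedding C M g"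
    and \<beta>: "2 * (C + 1) < \<beta>"
    and "X \<in> comp_closure \<beta> \<M>"
  shows "\<exists>f :: 'a \<Rightarrow> 'e. expansion_embedding (C + 2 * C * (C + 1) / (\<beta> - 2 * (C + 1))) X f"
proof -
  define A where "A = C + 2 * C * (C + 1) / (\<beta> - 2 * (C + 1))"
  have CA: "C \<le> A" using \<open>1 \<le> C\<close> \<beta> by (simp add: A_def)
  have fixpoint: "C + 2 * A * (C + 1) / \<beta> = A"
    using \<open>1 \<le> C\<close> \<beta> by (simp add: A_def divide_simps) algebra
  have "\<exists>f :: 'a \<Rightarrow> 'e. expansion_embedding A X f"
    using \<open>X \<in> comp_closure \<beta> \<M>\<close>
  proof induction
    case (base M)
    have "expansion_embedding A M g" if "expansion_embedding C M g" for g :: "'a \<Rightarrow> 'e"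
      using that CA unfolding expansion_embedding_def
      by (meson mdist_nonneg mult_right_mono order_trans)
    then show ?case using emb[OF base] by blast
  next
    case (comp M \<beta>' N)
    obtain g :: "'a \<Rightarrow> 'e" where g: "expansion_embedding C M g"
      using emb[OF comp(1)] ..
    have "\<forall>x\<in>mspace M. \<exists>h :: 'a \<Rightarrow> 'e. expansion_embedding A (N x) h"
      using comp(4) expansion_embedding_isometric by blast
    then obtain h :: "'a \<Rightarrow> 'a \<Rightarrow> 'e"
      where h: "\<And>x. x \<in> mspace M \<Longrightarrow> expansion_embedding A (N x) (h x)"
      by metis
    have "C + 2 * A * (C + 1) / \<beta>' \<le> C + 2 * A * (C + 1) / \<beta>"
      using \<open>1 \<le> C\<close> CA \<beta> comp(2) by (intro add_left_mono divide_left_mono) auto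
    then show ?case
      using expansion_embedding_composition[OF comp(3) g h] CA \<open>1 \<le> C\<close> fixpoint by simp
  qed
  then show ?thesis by (simp add: A_def)
qed

theorem corollary2p13:
  fixes C :: real
    and \<M> :: "'a metric set"
  assumes "C \<ge> 1"
    and "\<And>M. M \<in> \<M> \<Longrightarrow> finite (mspace M)"
    and "\<And>M. M \<in> \<M> \<Longrightarrow> embeddable C M (euclidean_metric :: 'e::banach metric)"
  shows "(\<forall>\<beta>. \<beta> > 2 * (C + 1) \<longrightarrow>
            (\<forall>X \<in> comp_closure \<beta> \<M>.
               embeddable (C + 2 * C * (C + 1) / (\<beta> - 2 * (C + 1))) X (euclidean_metric :: 'e metric))) \<and>
         (\<forall>\<epsilon> \<beta>. \<epsilon> > 0 \<longrightarrow> \<beta> > 2 * ((C + \<epsilon>) / \<epsilon>) * (C + 1) \<longrightarrow>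
            (\<forall>X \<in> comp_closure \<beta> \<M>. embeddable (C + \<epsilon>) X (euclidean_metric :: 'e metric)))"
proof -
  have emb: "\<exists>g :: 'a \<Rightarrow> 'e. expansion_embedding C M g" if "M \<in> \<M>" for M
    using assms(3)[OF that] by (simp add: embeddable_euclidean_iff)
  have main: "embeddable (C + 2 * C * (C + 1) / (\<beta> - 2 * (C + 1))) X (euclidean_metric :: 'e metric)"
    if "\<beta> > 2 * (C + 1)" "X \<in> comp_closure \<beta> \<M>" for \<beta> X
    using expansion_embedding_comp_closure[OF assms(1) emb that]
    by (simp add: embeddable_euclidean_iff)
  moreover have "embeddable (C + \<epsilon>) X (euclidean_metric :: 'e metric)"
    if \<epsilon>: "\<epsilon> > 0" and \<beta>: "\<beta> > 2 * ((C + \<epsilon>) / \<epsilon>) * (C + 1)" and X: "X \<in> comp_closure \<beta> \<M>" for \<epsilon> \<beta> X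
  proof -
    \<comment> \<open>In this form the hypothesis on \<open>\<beta>\<close> says that the excess over \<open>C\<close> is below \<open>\<epsilon>\<close>.\<close>
    have eq: "2 * ((C + \<epsilon>) / \<epsilon>) * (C + 1) = 2 * (C + 1) + 2 * C * (C + 1) / \<epsilon>"
      using \<epsilon> by (simp add: field_simps)
    have pos: "0 < 2 * C * (C + 1) / \<epsilon>" using \<epsilon> assms(1) by simp
    have gap: "2 * C * (C + 1) / \<epsilon> < \<beta> - 2 * (C + 1)" using \<beta> unfolding eq by linarith
    then have "2 * (C + 1) < \<beta>" using pos by linarith
    moreover have "2 * C * (C + 1) / (\<beta> - 2 * (C + 1)) \<le> \<epsilon>"
      using gap \<epsilon> \<open>2 * (C + 1) < \<beta>\<close> by (simp add: divide_less_eq divide_le_eq mult.commute)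
    ultimately show ?thesis
      using embeddable_mono[OF main[OF _ X]] by simp
  qed
  ultimately show ?thesis by blast
qed

end
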